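(* For $|u|$ sufficiently small \begin{equation*} {}_3F_2\left(\substack{\frac{1}{3},\frac{1}{2},\frac{2}{3}\\1,1};\frac{108u^2}{(1-4u)^3}\right)=(1-4u)\sum_{n=0}^{\infty}u^n\sum_{k=0}^{n}\binom{2n-2k}{n-k}\binom{2k}{k}\binom{n}{k}^2. \end{equation*} If $|u|$ is sufficiently small \begin{equation*} {}_3F_2\left(\substack{\frac{1}{4},\frac{1}{2},\frac{3}{4}\\1,1};\frac{256u}{9(1+3u)^4}\right)=\frac{1+3u}{1+u}\sum_{n=0}^{\infty}\left(\frac{u}{9(1+u)^2}\right)^n\binom{2n}{n}\sum_{k=0}^{n}\binom{2k}{k}\binom{n}{k}^2. \end{equation*}
   Context: ${}_3F_2$ denotes the generalized hypergeometric function $\sum_{n\ge0}\frac{(a_1)_n(a_2)_n(a_3)_n}{(b_1)_n(b_2)_n}\frac{x^n}{n!}$ with $(y)_n=\Gamma(y+n)/\Gamma(y)$, and $\binom{n}{k}$ is the binomial coefficient. *)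

theory Defs
  imports Complex_Main
begin

text \<open>
  \<^const>\<open>pochhammer\<close> agrees with $\Gamma(y+n)/\Gamma(y)$ whenever $y$ is not a
  nonpositive integer.
\<close>

definition hyp3F2_term ::
    "complex \<Rightarrow> complex \<Rightarrow> complex \<Rightarrow> complex \<Rightarrow> complex \<Rightarrow> complex \<Rightarrow> nat \<Rightarrow> complex" where
  "hyp3F2_term a1 a2 a3 b1 b2 x n =
     pochhammer a1 n * pochhammer a2 n * pochhammer a3 n
       / (pochhammer b1 n * pochhammer b2 n) * (x ^ n / fact n)"

text \<open>Meaningful only where the series converges.\<close>

definition hyp3F2 ::
    "complex \<Rightarrow> complex \<Rightarrow> complex \<Rightarrow> complex \<Rightarrow> complex \<Rightarrow> complex \<Rightarrow> complex" where
  "hyp3F2 a1 a2 a3 b1 b2 x = (\<Sum>n. hyp3F2_term a1 a2 a3 b1 b2 x n)"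

end

theory Submission
  imports Defs "HOL-Analysis.Analysis"
begin

text \<open>
  Expanding both sides in powers of $u$ by the negative binomial series reduces each identity to
  an identity between two finite sums. Both sums satisfy the same second order recurrence in $n$,
  which Zeilberger's creative telescoping establishes, and they agree for $n = 0, 1$.
  The outer sequence $\sum_k \binom{2k}{k}\binom{n}{k}^2$ in the second identity enters only
  through its own second order recurrence, so its defining sum need not be expanded there.
\<close>

section \<open>Creative telescoping\<close>

text \<open>The expansions have the shape sum_m c_m * u^(d*m) / (1 - b*u)^(p*m + 1); the prefactors
  of the theorem supply the extra factor 1/(1 - b*u). The first hypergeometric series has (d, b, p)
  = (2, 4, 3), and the other side is already a power series in u. In the second identity the
  hypergeometric side has (1, -3, 4) and the other side (1, -1, 2). The common coefficients are the
  Domb numbers 1, 4, 28, 256, ... and the Almkvist-Zudilin numbers 1, -3, 9, -3, ... divided by 9^n.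
  The obstacle to telescoping is the boundary: the certificate, as a rational multiple of the
  summand, has poles just beyond the range of summation. All terms are therefore related to one
  auxiliary term \<open>s k\<close>, whose reciprocal factorials belong to n + 2, by relations that
  never divide by an expression in n or k. What remains is a polynomial identity.\<close>

lemma recurrence_unique:
  fixes x y :: "nat \<Rightarrow> 'a::idom"
  assumes "\<And>n. p n * x (Suc (Suc n)) + q n * x (Suc n) + r n * x n = 0"
    and "\<And>n. p n * y (Suc (Suc n)) + q n * y (Suc n) + r n * y n = 0"
    and p: "\<And>n. p n \<noteq> 0" and "x 0 = y 0" "x 1 = y 1"
  shows "x n = y n"
proof -
  have "x n = y n \<and> x (Suc n) = y (Suc n)"
  proof (induction n)
    case (Suc n)
    have "p n * x (Suc (Suc n)) = p n * y (Suc (Suc n))"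
      using assms(1,2)[of n] Suc by (metis add_right_cancel)
    with Suc p show ?case by simp
  qed (use assms(4,5) in auto)
  then show ?thesis ..
qed

text \<open>Since \<open>t i k\<close> vanishes for k > i, all three sums may be taken over the
  common range k \<le> n + 2. There the right side collapses to G (n + 3) - G 0.\<close>

lemma creative_telescoping:
  fixes t :: "nat \<Rightarrow> nat \<Rightarrow> 'a::comm_ring_1"
  assumes "\<And>k. p * t (Suc (Suc n)) k + q * t (Suc n) k + r * t n k = G (Suc k) - G k"
    and t: "\<And>i k. i < k \<Longrightarrow> t i k = 0" and "G 0 = 0" "G (Suc (Suc (Suc n))) = 0"
  shows "p * (\<Sum>k\<le>Suc (Suc n). t (Suc (Suc n)) k) + q * (\<Sum>k\<le>Suc n. t (Suc n) k)
           + r * (\<Sum>k\<le>n. t n k) = 0"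
proof -
  have "(\<Sum>k\<le>Suc (Suc n). p * t (Suc (Suc n)) k + q * t (Suc n) k + r * t n k)
      = (\<Sum>k<Suc (Suc (Suc n)). G (Suc k) - G k)"
    using assms(1) by (simp only: lessThan_Suc_atMost)
  also have "\<dots> = 0"
    by (simp only: sum_lessThan_telescope assms(3,4)) simp
  finally show ?thesis
    by (simp add: sum.distrib sum_distrib_left t algebra_simps)
qed

section \<open>Reciprocal factorials and binomial coefficients\<close>

text \<open>With z = n - k, \<open>rGamma (z + 3)\<close> stands for 1/(n + 2 - k)!, the reciprocal
  of the largest of the three factorials that occur. The other two are polynomial multiples of it,
  also for k > n.\<close>

lemma rGamma_shift:
  fixes z :: complex
  shows "rGamma (z + 2) = (z + 2) * rGamma (z + 3)"
    and "rGamma (z + 1) = (z + 1) * (z + 2) * rGamma (z + 3)"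
  using rGamma_plus1[of "z + 1"] rGamma_plus1[of "z + 2"]
  by (simp_all add: add.assoc mult.assoc)

lemma rGamma_of_nat_diff_eq_0:
  "i < k \<Longrightarrow> rGamma (of_nat i - of_nat k + 1 :: complex) = 0"
proof -
  assume "i < k"
  then have "of_nat i - of_nat k + 1 = (- of_nat (k - Suc i) :: complex)"
    by (simp add: of_nat_diff)
  then show ?thesis
    by (simp add: rGamma_eq_zero_iff)
qed

lemma rGamma_of_nat_diff:
  "k \<le> n \<Longrightarrow> rGamma (of_nat n - of_nat k + 1) = inverse (fact (n - k) :: complex)"
proof -
  assume "k \<le> n"
  then have "of_nat n - of_nat k + 1 = (of_nat (Suc (n - k)) :: complex)"
    by (simp add: of_nat_diff)
  then show ?thesis
    by (metis rGamma_inverse_Gamma Gamma_fact of_nat_Suc add.commute)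
qed

lemma binomial_rGamma:
  "of_nat (n choose k) = fact n * rGamma (of_nat n - of_nat k + 1) * inverse (fact k :: complex)"
proof (cases "k \<le> n")
  case True
  then show ?thesis
    unfolding rGamma_of_nat_diff[OF True] by (simp add: binomial_fact divide_inverse mult_ac)
next
  case False
  then show ?thesis by (simp add: rGamma_of_nat_diff_eq_0)
qed

lemma of_nat_plus_1_neq_0: "of_nat k + 1 \<noteq> (0 :: complex)"
  by (metis of_nat_Suc of_nat_neq_0 add.commute)

text \<open>The quotient rule for 1/(k + 1)! in division-free form: \<open>algebra\<close> can treat
  the inverses as atoms, provided that each one at k + 1 comes with its factor k + 1.\<close>

lemma inverse_fact_Suc: "(of_nat k + 1) * inverse (fact (Suc k)) = (inverse (fact k) :: complex)"
  using of_nat_plus_1_neq_0[of k] by (simp add: add.commute)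

lemma central_binomial_fact: "of_nat ((2 * k) choose k)
    = fact (2 * k) * (inverse (fact k)^2 :: complex)"
  by (simp add: binomial_fact[of k "2 * k"] power2_eq_square divide_inverse flip: mult_2)

lemma fact_double_Suc: "fact (2 * Suc k)
    = 2 * (of_nat k + 1) * (2 * of_nat k + 1) * (fact (2 * k) :: complex)"
  by (simp add: algebra_simps)

section \<open>Recurrences\<close>

text \<open>
  In each of the following proofs, the rational certificate hidden in \<open>G\<close> was found by solving a
  linear system. Using \<^const>\<open>rGamma\<close> for the reciprocal factorial of a difference makes summands
  outside the range of summation vanish, so that the telescoping identity holds for all \<open>k\<close>.
\<close>

definition binom_square_sum :: "nat \<Rightarrow> nat" where
  "binom_square_sum n = (\<Sum>k\<le>n. ((2*k) choose k) * (n choose k)^2)"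

lemma binom_square_sum_recurrence:
  "(of_nat n + 2)^2 * of_nat (binom_square_sum (Suc (Suc n)))
    + - (10 * (of_nat n + 1)^2 + 10 * (of_nat n + 1) + 3) * of_nat (binom_square_sum (Suc n))
    + 9 * (of_nat n + 1)^2 * of_nat (binom_square_sum n) = (0::complex)"
proof -
  define t :: "nat \<Rightarrow> nat \<Rightarrow> complex"
    where "t n k = of_nat (((2*k) choose k) * (n choose k)^2)" for n k
  \<comment> \<open>The factorial is that of n + 1, between those of the three summands:
    \<open>t (Suc (Suc n))\<close> then needs only a polynomial factor, while for \<open>t n\<close>
    the missing (n + 1)^2 is supplied by its coefficient in the recurrence.\<close>
  define s :: "nat \<Rightarrow> complex"
    where "s k = fact (2 * k) * inverse (fact k) ^ 4 * (fact (Suc n) * rGamma (of_nat n - of_nat k + 3))^2"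
    for k
  \<comment> \<open>The ratio s (k + 1) / s k has denominator (k + 1)^3. The factor k^3 clears it in
    G (k + 1) and also gives G 0 = 0, which leaves only a linear polynomial in k to be
    determined.\<close>
  define G where "G k = s k * of_nat k ^ 3 * (3 * of_nat k - 4 * of_nat n - 8)" for k
  have *: "(of_nat n + 2)^2 * t (Suc (Suc n)) k + - (10 * (of_nat n + 1)^2 + 10 * (of_nat n + 1) + 3) * t (Suc n) k
      + 9 * (of_nat n + 1)^2 * t n k = G (Suc k) - G k" for k
  proof -
    define x y where "x = (of_nat n :: complex)" and "y = (of_nat k :: complex)"
    define R where "R = rGamma (x - y + 3)"
    have R: "rGamma (x - y + 2)
        = (x - y + 2) * R" "rGamma (x - y + 1) = (x - y + 1) * (x - y + 2) * R"
      unfolding R_def by (rule rGamma_shift)+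
    have t: "t j k = fact (2 * k) * inverse (fact k) ^ 4 * (fact j * rGamma (of_nat j - y + 1))^2" for j
      by (simp add: t_def central_binomial_fact binomial_rGamma[of j] power_mult_distrib y_def
          flip: power_add mult.assoc)
    have "t (Suc (Suc n)) k = (x + 2)^2 * s k"
    proof -
      have e: "of_nat (Suc (Suc n)) = x + 2" "x + 2 - y + 1 = x - y + 3" by (simp_all add: x_def)
      show ?thesis
        unfolding t s_def fact_Suc[of "Suc n"] e x_def[symmetric] y_def[symmetric] R_def[symmetric]
        by algebra
    qed
    moreover have "t (Suc n) k = (x - y + 2)^2 * s k"
    proof -
      have e: "of_nat (Suc n) - y + 1 = x - y + 2" by (simp add: x_def)
      show ?thesis
        unfolding t s_def e R x_def[symmetric] y_def[symmetric] R_def[symmetric] by algebra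
    qed
    moreover have "(x + 1)^2 * t n k = (x - y + 1)^2 * (x - y + 2)^2 * s k"
      unfolding t s_def x_def[symmetric] y_def[symmetric] R_def[symmetric] R fact_Suc of_nat_Suc
        by algebra
    moreover have "s (Suc k) * (y + 1)^3 = 2 * (2 * y + 1) * (x - y + 2)^2 * s k"
    proof -
      have e: "x - of_nat (Suc k) + 3 = x - y + 2" by (simp add: y_def)
      have "s (Suc k) * (y + 1)^3 = 2 * (2 * y + 1) * (x - y + 2)^2 *
          (fact (2 * k) * ((y + 1) * inverse (fact (Suc k)))^4 * (fact (Suc n) * R)^2)"
        unfolding s_def x_def[symmetric] fact_double_Suc y_def[symmetric] e R by algebra
      then show ?thesis
        unfolding s_def y_def inverse_fact_Suc by (simp add: R_def x_def y_def)
    qed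
    moreover have "G (Suc k) = (s (Suc k) * (y + 1) ^ 3) * (3 * (y + 1) - 4 * x - 8)"
      by (simp add: G_def x_def y_def add.commute)
    moreover have "G k = s k * y ^ 3 * (3 * y - 4 * x - 8)"
      by (simp add: G_def x_def y_def)
    ultimately show ?thesis
      unfolding x_def[symmetric] y_def[symmetric] by algebra
  qed
  have "t i k = 0" if "i < k" for i k
    using that by (simp add: t_def)
  \<comment> \<open>At k = n + 3 the term \<open>s\<close> contains \<open>rGamma 0\<close>, which
    is 0.\<close>
  moreover have "G 0 = 0" "G (Suc (Suc (Suc n))) = 0"
    using rGamma_of_nat_diff_eq_0[of "n + 2" "Suc (Suc (Suc n))"] by (simp_all add: G_def s_def)
  ultimately show ?thesis
    using creative_telescoping[of _ t, OF *] by (simp add: binom_square_sum_def t_def)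
qed

text \<open>The recurrence centred at k, solved for the highest term. At k = 0 the truncated
  \<open>k - 1\<close> does no harm, because its coefficient k^2 vanishes.\<close>

lemma binom_square_sum_recurrence':
  "(of_nat k + 1)^2 * of_nat (binom_square_sum (Suc k)) =
    (10 * of_nat k^2 + 10 * of_nat k + 3) * of_nat (binom_square_sum k)
    - 9 * of_nat k^2 * (of_nat (binom_square_sum (k - 1)) :: complex)"
proof (cases k)
  case 0
  then show ?thesis by (simp add: binom_square_sum_def)
next
  case (Suc n)
  then show ?thesis using binom_square_sum_recurrence[of n] by (simp add: algebra_simps)
qed

section \<open>Recurrence for the coefficients of the second identity\<close>

text \<open>For k \<le> n, \<open>t n k\<close> is (-1)^(n-k) / 9^k times binom(n+k, 2k) * binom(2k,
  k) * \<open>binom_square_sum k\<close>, the contribution of the k-th power to the coefficient of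
  u^n. Powers with exponent n - k are split into a part in n and a part in k, since natural
  subtraction would truncate for k > n.\<close>

lemma quartic_recurrence_left:
  fixes t :: "nat \<Rightarrow> nat \<Rightarrow> complex"
  defines "t \<equiv> \<lambda>n k. (-1)^n * (-1/9)^k * fact (n + k) * inverse (fact k)^2
      * rGamma (of_nat n - of_nat k + 1) * of_nat (binom_square_sum k)"
  shows "9 * (of_nat n + 2)^3 * (\<Sum>k\<le>Suc (Suc n). t (Suc (Suc n)) k)
    + (2 * of_nat n + 3) * (7 * (of_nat n + 1)^2 + 7 * (of_nat n + 1) + 3) * (\<Sum>k\<le>Suc n. t (Suc n) k)
    + 9 * (of_nat n + 1)^3 * (\<Sum>k\<le>n. t n k) = 0"
proof -
  \<comment> \<open>As a named constant, \<open>c\<close> enters the final polynomial computation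
    only through 9 * c = -1.\<close>
  define c :: complex where "c = -1/9"
  have c: "9 * c = -1" by (simp add: c_def)
  define s :: "nat \<Rightarrow> complex"
    where "s k = (-1)^n * c^k * fact (n + k) * inverse (fact k)^2 * rGamma (of_nat n - of_nat k + 3)" for k
  \<comment> \<open>A multiple of the summand alone is replaced by a combination of A k and A (k -
    1), where A is \<open>binom_square_sum\<close>. In G (k + 1) the value A (k + 1) carries the
    factor (k + 1)^2, so the recurrence of A reduces it without division. Both sides are then linear
    forms in A k and A (k - 1).\<close>
  define G where "G k = - s k * of_nat k^2 * (36 * of_nat n + 54) *
      (of_nat k^2 * of_nat (binom_square_sum k)
       + (of_nat n + of_nat k + 1) * (of_nat n - of_nat k + 2) * of_nat (binom_square_sum (k - 1)))" for k
  have *: "9 * (of_nat n + 2)^3 * t (Suc (Suc n)) k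
    + (2 * of_nat n + 3) * (7 * (of_nat n + 1)^2 + 7 * (of_nat n + 1) + 3) * t (Suc n) k
    + 9 * (of_nat n + 1)^3 * t n k = G (Suc k) - G k" for k
  proof -
    define A A' A'' where A_defs:
       "A = (of_nat (binom_square_sum k) :: complex)"
       "A' = (of_nat (binom_square_sum (Suc k)) :: complex)"
       "A'' = (of_nat (binom_square_sum (k - 1)) :: complex)"
    define x y where "x = (of_nat n :: complex)" and "y = (of_nat k :: complex)"
    define R where "R = rGamma (x - y + 3)"
    have R: "rGamma (x - y + 2)
        = (x - y + 2) * R" "rGamma (x - y + 1) = (x - y + 1) * (x - y + 2) * R"
      unfolding R_def by (rule rGamma_shift)+
    have args: "of_nat (Suc n) = x + 1" "of_nat (Suc (Suc n)) = x + 2" "of_nat n = x"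
      "of_nat k = y" "of_nat (Suc k) = y + 1"
      by (simp_all add: x_def y_def)
    have e: "x + 1 - y + 1 = x - y + 2" "x + 2 - y + 1 = x - y + 3" "x - (y + 1) + 3 = x - y + 2"
      by simp_all
    have facts: "fact (Suc (Suc n) + k) = (x + y + 1) * (x + y + 2) * (fact (n + k) :: complex)"
      "fact (Suc n + k) = (x + y + 1) * (fact (n + k) :: complex)"
      "fact (n + Suc k) = (x + y + 1) * (fact (n + k) :: complex)"
      by (simp_all add: x_def y_def algebra_simps)
    have "t (Suc (Suc n)) k = (x + y + 1) * (x + y + 2) * s k * A"
      unfolding t_def c_def[symmetric] s_def args e R R_def[symmetric] facts power_Suc A_defs
        by algebra
    moreover have "t (Suc n) k = - (x + y + 1) * (x - y + 2) * s k * A"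
      unfolding t_def c_def[symmetric] s_def args e R R_def[symmetric] facts power_Suc A_defs
        by algebra
    moreover have "t n k = (x - y + 1) * (x - y + 2) * s k * A"
      unfolding t_def c_def[symmetric] s_def args e R R_def[symmetric] A_defs by algebra
    moreover have "s (Suc k) * (y + 1)^2 = c * (x + y + 1) * (x - y + 2) * s k"
    proof -
      have "s (Suc k) * (y + 1)^2 = c * (x + y + 1) * (x - y + 2) *
          ((-1)^n * c^k * fact (n + k) * ((y + 1) * inverse (fact (Suc k)))^2 * R)"
        unfolding s_def args e R facts power_Suc by algebra
      then show ?thesis
        unfolding s_def y_def inverse_fact_Suc by (simp add: R_def x_def y_def)
    qed
    moreover have "G (Suc k) = - (s (Suc k) * (y + 1)^2) * (36 * x + 54) *
        ((y + 1)^2 * A' + (x + (y + 1) + 1) * (x - (y + 1) + 2) * A)"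
      unfolding G_def args A_defs by simp
    moreover have "G k = - s k * y^2 * (36 * x + 54) * (y^2 * A + (x + y + 1) * (x - y + 2) * A'')"
      unfolding G_def args A_defs by simp
    moreover have "(y + 1)^2 * A' = (10 * y^2 + 10 * y + 3) * A - 9 * y^2 * A''"
      unfolding A_defs y_def by (rule binom_square_sum_recurrence')
    moreover note c
    ultimately show ?thesis
      unfolding args by algebra
  qed
  have "t i k = 0" if "i < k" for i k
    using rGamma_of_nat_diff_eq_0[OF that] by (simp add: t_def)
  moreover have "G 0 = 0" "G (Suc (Suc (Suc n))) = 0"
    using rGamma_of_nat_diff_eq_0[of "n + 2" "Suc (Suc (Suc n))"] by (simp_all add: G_def s_def)
  ultimately show ?thesis
    using creative_telescoping[of _ t, OF *] by simp
qed

text \<open>For k \<le> n, \<open>t n k\<close> is (-3)^(n-k) / 9^k times binom(n+3k, 4k) *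
  (4k)!/k!^4, the coefficient of u^n contributed by the k-th hypergeometric term.\<close>

lemma quartic_recurrence_right:
  fixes t :: "nat \<Rightarrow> nat \<Rightarrow> complex"
  defines "t \<equiv> \<lambda>n k. (-3)^n * (-1/27)^k * fact (n + 3 * k) * inverse (fact k)^4
      * rGamma (of_nat n - of_nat k + 1)"
  shows "9 * (of_nat n + 2)^3 * (\<Sum>k\<le>Suc (Suc n). t (Suc (Suc n)) k)
    + (2 * of_nat n + 3) * (7 * (of_nat n + 1)^2 + 7 * (of_nat n + 1) + 3) * (\<Sum>k\<le>Suc n. t (Suc n) k)
    + 9 * (of_nat n + 1)^3 * (\<Sum>k\<le>n. t n k) = 0"
proof -
  define c :: complex where "c = -1/27"
  have c: "27 * c = -1" by (simp add: c_def)
  define s :: "nat \<Rightarrow> complex"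
    where "s k = (-3)^n * c^k * fact (n + 3 * k) * inverse (fact k)^4 * rGamma (of_nat n - of_nat k + 3)" for k
  \<comment> \<open>Once k^4 clears the denominator (k + 1)^4 of s (k + 1) / s k, a factor free of k
    suffices.\<close>
  define G where "G k = - s k * of_nat k^4 * (1296 * of_nat n + 2268)" for k
  have *: "9 * (of_nat n + 2)^3 * t (Suc (Suc n)) k
    + (2 * of_nat n + 3) * (7 * (of_nat n + 1)^2 + 7 * (of_nat n + 1) + 3) * t (Suc n) k
    + 9 * (of_nat n + 1)^3 * t n k = G (Suc k) - G k" for k
  proof -
    define x y where "x = (of_nat n :: complex)" and "y = (of_nat k :: complex)"
    define R where "R = rGamma (x - y + 3)"
    have R: "rGamma (x - y + 2)
        = (x - y + 2) * R" "rGamma (x - y + 1) = (x - y + 1) * (x - y + 2) * R"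
      unfolding R_def by (rule rGamma_shift)+
    have args: "of_nat (Suc n) = x + 1" "of_nat (Suc (Suc n)) = x + 2" "of_nat n = x"
      "of_nat k = y" "of_nat (Suc k) = y + 1"
      by (simp_all add: x_def y_def)
    have e: "x + 1 - y + 1 = x - y + 2" "x + 2 - y + 1 = x - y + 3" "x - (y + 1) + 3 = x - y + 2"
      by simp_all
    have facts: "fact (Suc (Suc n) + 3 * k)
        = (x + 3 * y + 1) * (x + 3 * y + 2) * (fact (n + 3 * k) :: complex)"
      "fact (Suc n + 3 * k) = (x + 3 * y + 1) * (fact (n + 3 * k) :: complex)"
      by (simp_all add: x_def y_def algebra_simps)
    have "t (Suc (Suc n)) k = 9 * (x + 3 * y + 1) * (x + 3 * y + 2) * s k"
      unfolding t_def c_def[symmetric] s_def args e R R_def[symmetric] facts power_Suc by algebra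
    moreover have "t (Suc n) k = - 3 * (x + 3 * y + 1) * (x - y + 2) * s k"
      unfolding t_def c_def[symmetric] s_def args e R R_def[symmetric] facts power_Suc by algebra
    moreover have "t n k = (x - y + 1) * (x - y + 2) * s k"
      unfolding t_def c_def[symmetric] s_def args e R R_def[symmetric] by algebra
    moreover have "s (Suc k) * (y + 1)^4
        = c * (x + 3 * y + 1) * (x + 3 * y + 2) * (x + 3 * y + 3) * (x - y + 2) * s k"
    proof -
      have f: "fact (n + 3 * Suc k)
          = (x + 3 * y + 3) * (x + 3 * y + 2) * (x + 3 * y + 1) * (fact (n + 3 * k) :: complex)"
        by (simp add: x_def y_def numeral_3_eq_3 algebra_simps)
      have "s (Suc k) * (y + 1)^4
        = c * (x + 3 * y + 1) * (x + 3 * y + 2) * (x + 3 * y + 3) * (x - y + 2) *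
          ((-3)^n * c^k * fact (n + 3 * k) * ((y + 1) * inverse (fact (Suc k)))^4 * R)"
        unfolding s_def args e R f power_Suc by algebra
      then show ?thesis
        unfolding s_def y_def inverse_fact_Suc by (simp add: R_def x_def y_def)
    qed
    moreover have "G (Suc k) = - (s (Suc k) * (y + 1)^4) * (1296 * x + 2268)"
      unfolding G_def args by simp
    moreover have "G k = - s k * y^4 * (1296 * x + 2268)"
      unfolding G_def args by simp
    moreover note c
    ultimately show ?thesis
      unfolding args by algebra
  qed
  have "t i k = 0" if "i < k" for i k
    using rGamma_of_nat_diff_eq_0[OF that] by (simp add: t_def)
  moreover have "G 0 = 0" "G (Suc (Suc (Suc n))) = 0"
    using rGamma_of_nat_diff_eq_0[of "n + 2" "Suc (Suc (Suc n))"] by (simp_all add: G_def s_def)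
  ultimately show ?thesis
    using creative_telescoping[of _ t, OF *] by simp
qed

section \<open>Recurrence for the coefficients of the first identity\<close>

text \<open>The argument n - 2k reflects the substitution in u^2. Summands with n < 2k vanish, so
  the range k \<le> n required by \<open>creative_telescoping\<close> can be kept. Raising k by one
  lowers n - 2k by two, which uses both shifts of \<open>rGamma\<close> at once.\<close>

lemma cubic_recurrence_right:
  fixes t :: "nat \<Rightarrow> nat \<Rightarrow> complex"
  defines "t \<equiv> \<lambda>n k. 4^n * (1/16)^k * fact (2 * k) * fact (n + k) * inverse (fact k)^5
      * rGamma (of_nat n - 2 * of_nat k + 1)"
  shows "(of_nat n + 2)^3 * (\<Sum>k\<le>Suc (Suc n). t (Suc (Suc n)) k)
    + - 2 * (2 * of_nat n + 3) * (5 * (of_nat n + 1)^2 + 5 * (of_nat n + 1) + 2) * (\<Sum>k\<le>Suc n. t (Suc n) k)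
    + 64 * (of_nat n + 1)^3 * (\<Sum>k\<le>n. t n k) = 0"
proof -
  define s :: "nat \<Rightarrow> complex"
    where "s k = 4^n * (1/16)^k * fact (2 * k) * fact (n + k) * inverse (fact k)^5
      * rGamma (of_nat n - 2 * of_nat k + 3)" for k
  define G where "G k = - s k * of_nat k^4 * (576 * of_nat n + 768)" for k
  have *: "(of_nat n + 2)^3 * t (Suc (Suc n)) k
    + - 2 * (2 * of_nat n + 3) * (5 * (of_nat n + 1)^2 + 5 * (of_nat n + 1) + 2) * t (Suc n) k
    + 64 * (of_nat n + 1)^3 * t n k = G (Suc k) - G k" for k
  proof -
    define x y where "x = (of_nat n :: complex)" and "y = (of_nat k :: complex)"
    define R where "R = rGamma (x - 2 * y + 3)"
    have R: "rGamma (x - 2 * y + 2) = (x - 2 * y + 2) * R"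
      "rGamma (x - 2 * y + 1) = (x - 2 * y + 1) * (x - 2 * y + 2) * R"
      unfolding R_def by (rule rGamma_shift)+
    have args: "of_nat (Suc n) = x + 1" "of_nat (Suc (Suc n)) = x + 2" "of_nat n = x"
      "of_nat k = y" "of_nat (Suc k) = y + 1"
      by (simp_all add: x_def y_def)
    have e: "x + 1 - 2 * y + 1 = x - 2 * y + 2" "x + 2 - 2 * y + 1 = x - 2 * y + 3"
      "x - 2 * (y + 1) + 3 = x - 2 * y + 1"
      by simp_all
    have facts: "fact (Suc (Suc n) + k) = (x + y + 1) * (x + y + 2) * (fact (n + k) :: complex)"
      "fact (Suc n + k) = (x + y + 1) * (fact (n + k) :: complex)"
      "fact (n + Suc k) = (x + y + 1) * (fact (n + k) :: complex)"
      by (simp_all add: x_def y_def algebra_simps)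
    have "t (Suc (Suc n)) k = 16 * (x + y + 1) * (x + y + 2) * s k"
      unfolding t_def s_def args e R R_def[symmetric] facts power_Suc by algebra
    moreover have "t (Suc n) k = 4 * (x + y + 1) * (x - 2 * y + 2) * s k"
      unfolding t_def s_def args e R R_def[symmetric] facts power_Suc by algebra
    moreover have "t n k = (x - 2 * y + 1) * (x - 2 * y + 2) * s k"
      unfolding t_def s_def args e R R_def[symmetric] by algebra
    moreover have "s (Suc k) * (y + 1)^4
        = (2 * y + 1) * (x + y + 1) * (x - 2 * y + 1) * (x - 2 * y + 2) / 8 * s k"
    proof -
      have "s (Suc k) * (y + 1)^4
        = (2 * y + 1) * (x + y + 1) * (x - 2 * y + 1) * (x - 2 * y + 2) / 8 *
          (4^n * (1/16)^k * fact (2 * k) * fact (n + k) * ((y + 1) * inverse (fact (Suc k)))^5 * R)"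
        unfolding s_def args e R power_Suc fact_double_Suc facts
        by (simp add: power_mult_distrib) algebra
      then show ?thesis
        unfolding s_def y_def inverse_fact_Suc by (simp add: R_def x_def y_def)
    qed
    moreover have "G (Suc k) = - (s (Suc k) * (y + 1)^4) * (576 * x + 768)"
      unfolding G_def args by simp
    moreover have "G k = - s k * y^4 * (576 * x + 768)"
      unfolding G_def args by simp
    ultimately show ?thesis
      unfolding args by algebra
  qed
  have "t i k = 0" if "i < k" for i k
    using rGamma_of_nat_diff_eq_0[of i "2 * k"] that by (simp add: t_def)
  moreover have "G 0 = 0" "G (Suc (Suc (Suc n))) = 0"
    using rGamma_of_nat_diff_eq_0[of "n + 2" "2 * Suc (Suc (Suc n))"] by (simp_all add: G_def s_def)
  ultimately show ?thesis
    using creative_telescoping[of _ t, OF *] by simp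
qed

text \<open>By parity a half-integer is never a pole of Gamma. An integer \<open>j\<close> is needed
  because n - k is negative for k > n.\<close>

lemma Gamma_half_integer_shift:
  "Gamma (of_int j + 1/2 + 1) = (of_int j + 1/2) * (Gamma (of_int j + 1/2) :: complex)"
proof (rule Gamma_plus1)
  have "of_int j + 1/2 \<noteq> (of_int i :: complex)" for i
  proof
    assume "of_int j + 1/2 = (of_int i :: complex)"
    then have "of_int (2 * j + 1) = (of_int (2 * i) :: complex)"
      by (simp add: field_simps)
    then have "2 * j + 1 = 2 * i" by (simp only: of_int_eq_iff)
    then show False by presburger
  qed
  then show "of_int j + 1/2 \<notin> (\<int>\<^sub>\<le>\<^sub>0 :: complex set)"
    by (auto elim!: nonpos_Ints_cases)
qed

text \<open>
  Up to a constant, $\Gamma(n-k+\frac12)$ encodes $\binom{2n-2k}{n-k}$ in a form whose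
  shift relations remain valid for $k > n$.
\<close>

lemma cubic_recurrence_left:
  fixes t :: "nat \<Rightarrow> nat \<Rightarrow> complex"
  defines "t \<equiv> \<lambda>n k. 4^n * (1/4)^k * fact (2 * k) * inverse (fact k)^4 * fact n^2
      * Gamma (of_nat n - of_nat k + 1/2) * rGamma (of_nat n - of_nat k + 1)^3"
  shows "(of_nat n + 2)^3 * (\<Sum>k\<le>Suc (Suc n). t (Suc (Suc n)) k)
    + - 2 * (2 * of_nat n + 3) * (5 * (of_nat n + 1)^2 + 5 * (of_nat n + 1) + 2) * (\<Sum>k\<le>Suc n. t (Suc n) k)
    + 64 * (of_nat n + 1)^3 * (\<Sum>k\<le>n. t n k) = 0"
proof -
  define s :: "nat \<Rightarrow> complex"
    where "s k = 4^n * (1/4)^k * fact (2 * k) * inverse (fact k)^4 * fact (Suc n)^2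
      * Gamma (of_nat n - of_nat k + 1/2) * rGamma (of_nat n - of_nat k + 3)^3" for k
  \<comment> \<open>The undetermined part of the certificate, of total degree 3 in k and in the
    central index m = n + 1 of the recurrence.\<close>
  define Q :: "complex \<Rightarrow> complex \<Rightarrow> complex"
    where "Q m y = -4 + 22 * y - 24 * y^2 + 8 * y^3 + m * (-32 + 74 * y - 36 * y^2) + m^2 * (-52 + 52 * y) - 24 * m^3" for m y
  \<comment> \<open>At k + 1 the factor n - k + 1/2 becomes n - k - 1/2, exactly what turns Gamma (n
    - k - 1/2) back into Gamma (n - k + 1/2); k^3 plays the same part for the factorials.\<close>
  define G where "G k = 4 * s k * of_nat k^3 * (of_nat n - of_nat k + 1/2) * Q (of_nat n + 1) (of_nat k)" for k
  have *: "(of_nat n + 2)^3 * t (Suc (Suc n)) k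
    + - 2 * (2 * of_nat n + 3) * (5 * (of_nat n + 1)^2 + 5 * (of_nat n + 1) + 2) * t (Suc n) k
    + 64 * (of_nat n + 1)^3 * t n k = G (Suc k) - G k" for k
  proof -
    define x y where "x = (of_nat n :: complex)" and "y = (of_nat k :: complex)"
    define R where "R = rGamma (x - y + 3)"
    have R: "rGamma (x - y + 2)
        = (x - y + 2) * R" "rGamma (x - y + 1) = (x - y + 1) * (x - y + 2) * R"
      unfolding R_def by (rule rGamma_shift)+
    have args: "of_nat (Suc n) = x + 1" "of_nat (Suc (Suc n)) = x + 2" "of_nat n = x"
      "of_nat k = y" "of_nat (Suc k) = y + 1"
      by (simp_all add: x_def y_def)
    have e: "x + 1 - y + 1 = x - y + 2" "x + 2 - y + 1 = x - y + 3" "x - (y + 1) + 3 = x - y + 2"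
      by simp_all
    define W where "W = Gamma (x - y + 1/2)"
    have W1: "Gamma (x + 1 - y + 1/2) = (x - y + 1/2) * W"
      using Gamma_half_integer_shift[of "int n - int k"]
      by (simp add: W_def x_def y_def algebra_simps)
    have "Gamma (x + 2 - y + 1/2) = (x - y + 3/2) * Gamma (x + 1 - y + 1/2)"
      using Gamma_half_integer_shift[of "int n - int k + 1"]
      by (simp add: x_def y_def algebra_simps)
    then have W2: "Gamma (x + 2 - y + 1/2) = (x - y + 3/2) * (x - y + 1/2) * W"
      by (simp only: W1 mult.assoc)
    have W3: "(x - y - 1/2) * Gamma (x - (y + 1) + 1/2) = W"
      using Gamma_half_integer_shift[of "int n - int k - 1"]
      by (simp add: W_def x_def y_def algebra_simps)
    note W = W1 W2
    have T2: "t (Suc (Suc n)) k = 16 * (x - y + 3/2) * (x - y + 1/2) * (x + 2)^2 * s k"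
      unfolding t_def s_def args e R W R_def[symmetric] W_def[symmetric] fact_Suc[of "Suc n"] power_Suc
        by (simp add: power_mult_distrib)
    have T1: "t (Suc n) k = 4 * (x - y + 1/2) * (x - y + 2)^3 * s k"
      unfolding t_def s_def args e R W R_def[symmetric] W_def[symmetric] power_Suc
        by (simp add: power_mult_distrib)
    have T0: "(x + 1)^2 * t n k = (x - y + 1)^3 * (x - y + 2)^3 * s k"
      unfolding t_def s_def args e R R_def[symmetric] W_def[symmetric] fact_Suc[of n]
        by (simp add: power_mult_distrib)
    have S: "s (Suc k) * (y + 1)^3 * (x - y - 1/2) = (2 * y + 1) * (x - y + 2)^3 / 2 * s k"
    proof -
      have "s (Suc k) * (y + 1)^3 * (x - y - 1/2) = (2 * y + 1) * (x - y + 2)^3 / 2 *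
          (4^n * (1/4)^k * fact (2 * k) * ((y + 1) * inverse (fact (Suc k)))^4 * fact (Suc n)^2 *
           ((x - y - 1/2) * Gamma (x - (y + 1) + 1/2)) * R^3)"
        unfolding s_def args e R power_Suc fact_double_Suc
        by (simp add: power_mult_distrib) algebra
      then show ?thesis
        unfolding s_def y_def inverse_fact_Suc W3[unfolded y_def]
          by (simp add: R_def W_def x_def y_def)
    qed
    have G1: "G (Suc k) = 4 * (s (Suc k) * (y + 1)^3 * (x - y - 1/2)) * Q (x + 1) (y + 1)"
      unfolding G_def args by simp
    have G0: "G k = 4 * s k * y^3 * (x - y + 1/2) * Q (x + 1) y"
      unfolding G_def args by simp
    \<comment> \<open>Regrouped because \<open>T0\<close> determines only the multiple (x + 1)^2 of
      \<open>t n k\<close>.\<close>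
    have "(x + 2)^3 * t (Suc (Suc n)) k + - 2 * (2 * x + 3) * (5 * (x + 1)^2 + 5 * (x + 1) + 2) * t (Suc n) k
        + 64 * (x + 1)^3 * t n k
      = (x + 2)^3 * t (Suc (Suc n)) k + - 2 * (2 * x + 3) * (5 * (x + 1)^2 + 5 * (x + 1) + 2) * t (Suc n) k
        + 64 * (x + 1) * ((x + 1)^2 * t n k)"
      by algebra
    also have "\<dots> = G (Suc k) - G k"
      unfolding T2 T1 T0 G1 G0 S Q_def by algebra
    finally show ?thesis
      unfolding args .
  qed
  have "t i k = 0" if "i < k" for i k
    using rGamma_of_nat_diff_eq_0[OF that] by (simp add: t_def)
  moreover have "G 0 = 0" "G (Suc (Suc (Suc n))) = 0"
    using rGamma_of_nat_diff_eq_0[of "n + 2" "Suc (Suc (Suc n))"] by (simp_all add: G_def s_def)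
  ultimately show ?thesis
    using creative_telescoping[of _ t, OF *] by simp
qed

section \<open>Rational substitutions in power series\<close>

text \<open>Induction on q: one more factor 1/(1 - z) is a Cauchy product with the geometric series,
  and the resulting sum of binomials is the hockey-stick identity. Absolute convergence is carried
  along because the Cauchy product needs it. The field is general since both complex z and real
  norms are inserted later.\<close>

lemma negative_binomial_sums:
  fixes z :: "'a::{real_normed_field,banach}"
  assumes z: "norm z < 1"
  shows "summable (\<lambda>j. norm (of_nat ((j + q) choose q) * z^j))"
    and "(\<lambda>j. of_nat ((j + q) choose q) * z^j) sums (1 / (1 - z)^Suc q)"
proof -
  have geo: "(\<Sum>i\<le>j. of_nat ((i + q) choose q) * w^i * w^(j - i))
      = of_nat ((j + Suc q) choose (Suc q)) * w^j"
    for w :: "'b::comm_ring_1" and q j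
  proof -
    have "(\<Sum>i\<le>j. of_nat ((i + q) choose q) * w^i * w^(j - i))
        = (\<Sum>i\<le>j. of_nat ((q + i) choose q)) * w^j"
      unfolding sum_distrib_right
      by (intro sum.cong) (auto simp: add.commute mult.assoc simp flip: power_add)
    also have "(\<Sum>i\<le>j. of_nat ((q + i) choose q))
        = (of_nat ((q + j + 1) choose (q + 1)) :: 'b)"
      using choose_rising_sum(1)[of q j] by (metis of_nat_sum)
    finally show ?thesis by (simp add: add.commute del: binomial_Suc_Suc)
  qed
  have "summable (\<lambda>j. norm (of_nat ((j + q) choose q) * z^j)) \<and>
    (\<lambda>j. of_nat ((j + q) choose q) * z^j) sums (1 / (1 - z)^Suc q)"
  proof (induction q)
    case 0
    show ?case
      using z geometric_sums[OF z] by (simp add: norm_power summable_geometric)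
  next
    case (Suc q)
    have g: "summable (\<lambda>j. norm (z^j))" "(\<lambda>j. z^j) sums (1 / (1 - z))"
      using z geometric_sums[OF z] by (simp_all add: norm_power summable_geometric)
    have "(\<lambda>j. \<Sum>i\<le>j. of_nat ((i + q) choose q) * z^i * z^(j - i)) sums
      ((\<Sum>j. of_nat ((j + q) choose q) * z^j) * (\<Sum>j. z^j))"
      by (rule Cauchy_product_sums) (use Suc g in auto)
    then have "(\<lambda>j. of_nat ((j + Suc q) choose (Suc q)) * z^j) sums (1 / (1 - z)^Suc (Suc q))"
      unfolding geo using Suc g by (simp add: sums_iff del: binomial_Suc_Suc)
    moreover have "summable (\<lambda>j. \<Sum>i\<le>j. norm (of_nat ((i + q) choose q) * z^i) * norm (z^(j - i)))"
      by (rule summable_Cauchy_product) (use Suc g in auto)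
    then have "summable (\<lambda>j. norm (of_nat ((j + Suc q) choose (Suc q)) * z^j))"
      using geo[of q "norm z"] by (simp add: norm_mult norm_power del: binomial_Suc_Suc)
    ultimately show ?case by blast
  qed
  then show "summable (\<lambda>j. norm (of_nat ((j + q) choose q) * z^j))"
    and "(\<lambda>j. of_nat ((j + q) choose q) * z^j) sums (1 / (1 - z)^Suc q)"
    by blast+
qed

text \<open>Each u^(d*m) / (1 - b*u)^(p*m + 1) is a negative binomial series in j; collecting the
  terms with n = j + d*m gives the inner sums, which are finite because d > 0. The geometric bound
  on \<open>c\<close> makes the double family absolutely summable for small u.\<close>

lemma rational_substitution_sums:
  fixes b :: complex and c :: "nat \<Rightarrow> complex"
  assumes c: "\<And>m. norm (c m) \<le> K^m" and K: "K \<ge> 0" and d: "d > 0"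
  shows "\<exists>r>0. \<forall>u::complex. norm u < r \<longrightarrow> b * u \<noteq> 1 \<and>
    summable (\<lambda>m. c m * (u^d / (1 - b * u)^p)^m) \<and>
    (\<lambda>n. u^n * (\<Sum>m | d * m \<le> n. c m * of_nat ((n - d * m + p * m) choose (p * m)) * b^(n - d * m)))
      sums ((\<Sum>m. c m * (u^d / (1 - b * u)^p)^m) / (1 - b * u))"
proof (intro exI conjI allI impI)
  \<comment> \<open>Chosen so that |u| < r gives |b*u| \<le> 1/2, |u| \<le> 1 and K * |u| * 2^p
    \<le> 1/2 together. The power 2^p bounds 1/(1 - |b*u|)^p.\<close>
  define r where "r = 1 / (2 * (1 + norm b) * (1 + K) * 2^p)"
  show "r > 0"
    unfolding r_def using K by (auto intro!: divide_pos_pos mult_pos_pos add_pos_nonneg)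
  fix u :: complex assume "norm u < r"
  then have ru: "norm u * (2 * (1 + norm b) * (1 + K) * 2^p) \<le> 1"
    using K \<open>r > 0\<close> by (simp add: r_def field_simps)
  have ge: "norm u * (A * B * C * D) \<le> norm u * (2 * (1 + norm b) * (1 + K) * 2^p)"
    if "0 \<le> A" "0 \<le> B" "0 \<le> C" "0 \<le> D" "A \<le> 2" "B \<le> 1 + norm b" "C \<le> 1 + K" "D \<le> 2^p" for A B C D :: real
    using that K by (intro mult_left_mono mult_mono mult_nonneg_nonneg) auto
  have p1: "1 \<le> (2::real)^p" by simp
  have "norm (b * u) * 2 \<le> 1"
    using ge[of 2 "norm b" 1 1] K p1 ru by (simp add: norm_mult mult_ac)
  then have bu: "norm (b * u) \<le> 1/2" by simp
  have "norm u \<le> 1" using ge[of 1 1 1 1] K p1 ru by simp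
  have Ku: "K * norm u * 2^p \<le> 1/2"
    using ge[of 2 1 K "2^p"] K p1 ru by (simp add: mult_ac)
  show "b * u \<noteq> 1"
    using bu by auto
  define f where "f = (\<lambda>(m, j). c m * u^(d * m) * (of_nat ((j + p * m) choose (p * m)) * (b * u)^j))"
  have inner: "summable (\<lambda>j. norm (f (m, j)))"
    "(\<lambda>j. f (m, j)) sums (c m * u^(d * m) * (1 / (1 - b * u)^Suc (p * m)))"
    "(\<lambda>j. norm (f (m, j))) sums (norm (c m * u^(d * m)) * (1 / (1 - norm (b * u))^Suc (p * m)))" for m
  proof -
    have 1: "norm (b * u) < 1" using bu by simp
    show "summable (\<lambda>j. norm (f (m, j)))"
      unfolding f_def prod.case norm_mult[of "c m * _"] using negative_binomial_sums(1)[OF 1]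
        by (rule summable_mult)
    show "(\<lambda>j. f (m, j)) sums (c m * u^(d * m) * (1 / (1 - b * u)^Suc (p * m)))"
      unfolding f_def prod.case using negative_binomial_sums(2)[OF 1] by (rule sums_mult)
    have 2: "norm (norm (b * u)) < 1" using 1 by simp
    show "(\<lambda>j. norm (f (m, j))) sums (norm (c m * u^(d * m)) * (1 / (1 - norm (b * u))^Suc (p * m)))"
      unfolding f_def prod.case norm_mult[of "c m * _"] norm_mult[of "of_nat _"] norm_power norm_of_nat
      using negative_binomial_sums(2)[OF 2, of "p * m"] by (intro sums_mult) (simp add: norm_power)
  qed
  \<comment> \<open>The left side is the sum over j of the norms; the constant 2 comes from the one
    extra power of 1/(1 - |b*u|).\<close>
  have outer: "norm (c m * u^(d * m)) * (1 / (1 - norm (b * u))^Suc (p * m))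
      \<le> 2 * (1/2)^m" for m
  proof -
    have "norm u^d \<le> norm u"
      using \<open>norm u \<le> 1\<close> d power_decreasing[of 1 d "norm u"] by simp
    then have "norm (c m * u^(d * m)) \<le> K^m * norm u^m"
      unfolding norm_mult norm_power power_mult using c[of m] K by (intro mult_mono power_mono) auto
    moreover have "1 / (1 - norm (b * u))^Suc (p * m) \<le> 2^Suc (p * m)"
    proof -
      have "(1/2)^Suc (p * m) \<le> (1 - norm (b * u))^Suc (p * m)"
        using bu by (intro power_mono) auto
      then show ?thesis
        using bu by (simp add: field_simps power_divide)
    qed
    ultimately have "norm (c m * u^(d * m)) * (1 / (1 - norm (b * u))^Suc (p * m))
        \<le> K^m * norm u^m * 2^Suc (p * m)"
      using bu K by (intro mult_mono) auto
    also have "\<dots> = 2 * (K * norm u * 2^p)^m"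
      by (simp add: power_mult_distrib power_mult)
    also have "\<dots> \<le> 2 * (1/2)^m"
      using Ku K by (intro mult_left_mono power_mono) auto
    finally show ?thesis .
  qed
  have sum_m: "summable (\<lambda>m. norm (c m * u^(d * m)) * (1 / (1 - norm (b * u))^Suc (p * m)))"
    using bu
      by (intro summable_comparison_test'[OF summable_mult[OF summable_geometric[of "1/2::real"]]] )
      (use outer in \<open>auto simp: abs_mult\<close>)
  have inner_has_sum: "((\<lambda>j. norm (f (m, j))) has_sum (norm (c m * u^(d * m)) * (1 / (1 - norm (b * u))^Suc (p * m)))) UNIV" for m
    using inner(3) by (intro sums_nonneg_imp_has_sum) auto
  have "(\<lambda>x. norm (f x)) summable_on (UNIV \<times> UNIV)"
  proof (rule summable_on_SigmaI)
    show "(\<lambda>m. norm (c m * u^(d * m)) * (1 / (1 - norm (b * u))^Suc (p * m))) summable_on UNIV"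
      using bu by (intro summable_nonneg_imp_summable_on sum_m) auto
  qed (use inner_has_sum in auto)
  then have "f summable_on (UNIV \<times> UNIV)"
    by (rule abs_summable_summable)
  then obtain S where S: "(f has_sum S) (UNIV \<times> UNIV)"
    by (auto simp: summable_on_def)
  have "((\<lambda>j. f (m, j)) has_sum (c m * u^(d * m) * (1 / (1 - b * u)^Suc (p * m)))) UNIV" for m
    by (rule norm_summable_imp_has_sum[OF inner(1,2)])
  \<comment> \<open>Summing over j first evaluates the total S as the substituted series divided by
    1 - b*u.\<close>
  from has_sum_SigmaD[OF S this]
  have "(\<lambda>m. c m * u^(d * m) * (1 / (1 - b * u)^Suc (p * m))) sums S"
    by (intro has_sum_imp_sums) auto
  then have "(\<lambda>m. c m * u^(d * m) * (1 / (1 - b * u)^Suc (p * m)) * (1 - b * u)) sums (S * (1 - b * u))"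
    by (rule sums_mult2)
  also have "(\<lambda>m. c m * u^(d * m) * (1 / (1 - b * u)^Suc (p * m)) * (1 - b * u))
      = (\<lambda>m. c m * (u^d / (1 - b * u)^p)^m)"
    using \<open>b * u \<noteq> 1\<close> by (simp add: power_divide power_mult)
  finally have L: "(\<lambda>m. c m * (u^d / (1 - b * u)^p)^m) sums (S * (1 - b * u))" .
  then show "summable (\<lambda>m. c m * (u^d / (1 - b * u)^p)^m)"
    by (rule sums_summable)
  \<comment> \<open>Now the same total is summed along the diagonals j + d*m = n. The condition d *
    m \<le> n makes the natural subtraction exact.\<close>
  have "bij_betw (\<lambda>(n, m). (m, n - d * m)) (SIGMA n:UNIV. {m. d * m \<le> n}) (UNIV \<times> UNIV)"
    by (rule bij_betwI[where g = "\<lambda>(m, j). (j + d * m, m)"]) auto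
  from S[folded has_sum_reindex_bij_betw[OF this]]
  have R: "((\<lambda>x. f (case x of (n, m) \<Rightarrow> (m, n - d * m))) has_sum S) (SIGMA n:UNIV. {m. d * m \<le> n})" .
  have "finite {m. d * m \<le> n}" for n
    by (rule finite_subset[of _ "{..n}"]) (use d in \<open>auto intro: order_trans[rotated]\<close>)
  from has_sum_SigmaD[OF R has_sum_finite[OF this]]
  have "(\<lambda>n. \<Sum>m | d * m \<le> n. f (m, n - d * m)) sums S"
    by (intro has_sum_imp_sums) auto
  also have "(\<lambda>n. \<Sum>m | d * m \<le> n. f (m, n - d * m)) =
    (\<lambda>n. u^n * (\<Sum>m | d * m \<le> n. c m * of_nat ((n - d * m + p * m) choose (p * m)) * b^(n - d * m)))"
    unfolding sum_distrib_left f_def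
    by (intro ext sum.cong) (auto simp: power_mult_distrib simp flip: power_add)
  finally show "(\<lambda>n. u^n * (\<Sum>m | d * m \<le> n. c m * of_nat ((n - d * m + p * m) choose (p * m)) * b^(n - d * m)))
      sums ((\<Sum>m. c m * (u^d / (1 - b * u)^p)^m) / (1 - b * u))"
    using L \<open>b * u \<noteq> 1\<close> by (simp add: sums_iff)
qed

section \<open>The coefficient identities\<close>

lemma central_binomial_Gamma:
  "Gamma (of_nat m + 1/2) = of_nat ((2 * m) choose m) * fact m * Gamma (1/2) / (4^m :: complex)"
proof -
  have nonpos: "(1/2 :: complex) \<notin> \<int>\<^sub>\<le>\<^sub>0"
    by (simp add: Gamma_eq_zero_iff[symmetric] Gamma_one_half_complex)
  have "Gamma (1/2 + of_nat m) = pochhammer (1/2) m * (Gamma (1/2) :: complex)"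
    by (simp add: pochhammer_Gamma Gamma_one_half_complex nonpos)
  moreover have "pochhammer (1/2) m = of_nat ((2 * m) choose m) * fact m / (4^m :: complex)"
    unfolding central_binomial_fact fact_double by (simp add: power_mult power2_eq_square)
  ultimately show ?thesis by (simp add: add.commute)
qed

lemma Domb_number_identity:
  "of_nat (\<Sum>k=0..n. ((2*n - 2*k) choose (n - k)) * ((2*k) choose k) * (n choose k)^2) =
    (\<Sum>m | 2 * m \<le> n. of_nat (((2*m) choose m)^2 * ((3*m) choose m)) *
      of_nat ((n - 2 * m + 3 * m) choose (3 * m)) * (4::complex)^(n - 2 * m))"
proof -
  define tL :: "nat \<Rightarrow> nat \<Rightarrow> complex"
    where "tL n k = 4^n * (1/4)^k * fact (2 * k) * inverse (fact k)^4 * fact n^2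
      * Gamma (of_nat n - of_nat k + 1/2) * rGamma (of_nat n - of_nat k + 1)^3" for n k
  define tR :: "nat \<Rightarrow> nat \<Rightarrow> complex"
    where "tR n k = 4^n * (1/16)^k * fact (2 * k) * fact (n + k) * inverse (fact k)^5
      * rGamma (of_nat n - 2 * of_nat k + 1)" for n k
  define D where "D n = (\<Sum>k\<le>n. tL n k)" for n
  define E where "E n = (\<Sum>k\<le>n. tR n k)" for n
  have Gamma_half: "Gamma (1/2) \<noteq> (0 :: complex)"
    by (simp add: Gamma_one_half_complex)
  have tL: "tL n k
      = Gamma (1/2) * of_nat (((2*n - 2*k) choose (n - k)) * ((2*k) choose k) * (n choose k)^2)"
    if "k \<le> n" for n k
  proof -
    have "of_nat n - of_nat k + 1/2 = of_nat (n - k) + (1/2 :: complex)"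
      using that by (simp add: of_nat_diff)
    moreover have "(4::complex)^n * (1/4)^k = 4^(n - k)"
      using that by (simp add: power_diff power_divide)
    moreover have "rGamma (of_nat (n - k) + 1) = inverse (fact (n - k) :: complex)"
      using rGamma_of_nat_diff[OF that] that by (simp add: of_nat_diff)
    ultimately have "tL n k = of_nat ((2*(n-k)) choose (n - k)) * Gamma (1/2) *
        (fact (n - k) * inverse (fact (n - k))) * (fact (2 * k) * inverse (fact k)^2)
        * (fact n * inverse (fact (n - k)) * inverse (fact k))^2"
      by (simp add: tL_def central_binomial_Gamma rGamma_of_nat_diff[OF that] power2_eq_square
          power3_eq_cube power4_eq_xxxx)
    then show ?thesis
      unfolding central_binomial_fact[symmetric] rGamma_of_nat_diff[OF that, symmetric] binomial_rGamma[symmetric]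
      by (simp add: rGamma_of_nat_diff[OF that] diff_mult_distrib2)
  qed
  \<comment> \<open>The Gamma encoding of the central binomials makes \<open>D\<close> larger by the
    constant Gamma (1/2), which is nonzero and cancels afterwards.\<close>
  have "Gamma (1/2) * E n = D n" for n
  proof (rule recurrence_unique)
    fix n
    show "(of_nat n + 2)^3 * D (Suc (Suc n))
        + - 2 * (2 * of_nat n + 3) * (5 * (of_nat n + 1)^2 + 5 * (of_nat n + 1) + 2) * D (Suc n)
        + 64 * (of_nat n + 1)^3 * D n = 0"
      unfolding D_def tL_def by (rule cubic_recurrence_left)
    have "(of_nat n + 2)^3 * E (Suc (Suc n))
        + - 2 * (2 * of_nat n + 3) * (5 * (of_nat n + 1)^2 + 5 * (of_nat n + 1) + 2) * E (Suc n)
        + 64 * (of_nat n + 1)^3 * E n = 0"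
      unfolding E_def tR_def by (rule cubic_recurrence_right)
    then show "(of_nat n + 2)^3 * (Gamma (1/2) * E (Suc (Suc n)))
        + - 2 * (2 * of_nat n + 3) * (5 * (of_nat n + 1)^2 + 5 * (of_nat n + 1) + 2) * (Gamma (1/2) * E (Suc n))
        + 64 * (of_nat n + 1)^3 * (Gamma (1/2) * E n) = 0"
      by algebra
    have "of_nat (Suc (Suc n)) \<noteq> (0 :: complex)"
      by (simp only: of_nat_eq_0_iff)
    then show "(of_nat n + 2 :: complex)^3 \<noteq> 0"
      by (simp add: add.commute)
  next
    show "Gamma (1/2) * E 0 = D 0"
      unfolding D_def using tL[of 0 0] by (simp add: E_def tR_def)
    have "rGamma 0 = (0::complex)" "rGamma (-1) = (0::complex)" "rGamma 2 = (1::complex)"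
      using rGamma_of_nat_diff_eq_0[of 0 1] rGamma_of_nat_diff_eq_0[of 0 2] rGamma_of_nat_diff[of 0 1]
        by simp_all
    then show "Gamma (1/2) * E 1 = D 1"
      unfolding D_def using tL[of 0 1] tL[of 1 1] by (simp add: E_def tR_def)
  qed
  then have "of_nat (\<Sum>k=0..n. ((2*n - 2*k) choose (n - k)) * ((2*k) choose k) * (n choose k)^2)
      = E n"
    using Gamma_half tL unfolding D_def by (simp add: atLeast0AtMost flip: sum_distrib_left)
  also have "E n = (\<Sum>m | 2 * m \<le> n. tR n m)"
    unfolding E_def
  proof (rule sum.mono_neutral_right)
    show "\<forall>i\<in>{..n} - {m. 2 * m \<le> n}. tR n i = 0"
      using rGamma_of_nat_diff_eq_0[of n "2 * i" for i] by (auto simp: tR_def)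
  qed auto
  also have "\<dots> = (\<Sum>m | 2 * m \<le> n. of_nat (((2*m) choose m)^2 * ((3*m) choose m)) *
      of_nat ((n - 2 * m + 3 * m) choose (3 * m)) * (4::complex)^(n - 2 * m))"
  proof (intro sum.cong refl)
    fix m assume "m \<in> {m. 2 * m \<le> n}"
    then have m: "2 * m \<le> n" by simp
    have 1: "(4::complex)^n * (1/16)^m = 4^(n - 2 * m)"
      using m by (simp add: power_diff power_divide power_mult)
    have 2: "rGamma (of_nat n - 2 * of_nat m + 1) = inverse (fact (n - 2 * m) :: complex)"
      using rGamma_of_nat_diff[OF m] by simp
    have 3: "of_nat ((3*m) choose m) = (fact (3 * m) / (fact m * fact (2 * m)) :: complex)"
      using binomial_fact[of m "3 * m", where 'a = complex] by simp
    have "n - 2 * m + 3 * m - 3 * m = n - 2 * m" "n - 2 * m + 3 * m = n + m"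
      using m by simp_all
    then have 4: "of_nat ((n - 2 * m + 3 * m) choose (3 * m))
        = (fact (n + m) / (fact (3 * m) * fact (n - 2 * m)) :: complex)"
      using binomial_fact[of "3 * m" "n - 2 * m + 3 * m", where 'a = complex]
        by (simp add: add.commute)
    show "tR n m = of_nat (((2*m) choose m)^2 * ((3*m) choose m)) *
      of_nat ((n - 2 * m + 3 * m) choose (3 * m)) * (4::complex)^(n - 2 * m)"
      unfolding tR_def of_nat_mult of_nat_power central_binomial_fact 1 2 3 4
      by (simp add: field_simps eval_nat_numeral del: fact_Suc)
  qed
  finally show ?thesis .
qed

text \<open>The factors \<open>1 * m\<close> match the instance \<open>d = 1\<close> of \<open>rational_substitution_sums\<close>.\<close>

lemma quartic_identity:
  "(\<Sum>m | 1 * m \<le> n. (of_nat ((2*m) choose m) * of_nat (binom_square_sum m) / 9^m) *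
      of_nat ((n - 1 * m + 2 * m) choose (2 * m)) * (-1 :: complex)^(n - 1 * m)) =
   (\<Sum>m | 1 * m \<le> n. (fact (4*m) / (fact m^4 * 9^m)) *
      of_nat ((n - 1 * m + 4 * m) choose (4 * m)) * (-3 :: complex)^(n - 1 * m))"
proof -
  define tL :: "nat \<Rightarrow> nat \<Rightarrow> complex"
    where "tL n k = (-1)^n * (-1/9)^k * fact (n + k) * inverse (fact k)^2
      * rGamma (of_nat n - of_nat k + 1) * of_nat (binom_square_sum k)" for n k
  define tR :: "nat \<Rightarrow> nat \<Rightarrow> complex"
    where "tR n k = (-3)^n * (-1/27)^k * fact (n + 3 * k) * inverse (fact k)^4
      * rGamma (of_nat n - of_nat k + 1)" for n k
  define D where "D n = (\<Sum>k\<le>n. tL n k)" for n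
  define E where "E n = (\<Sum>k\<le>n. tR n k)" for n
  have "D n = E n" for n
  proof (rule recurrence_unique)
    fix n
    show "9 * (of_nat n + 2)^3 * D (Suc (Suc n))
        + (2 * of_nat n + 3) * (7 * (of_nat n + 1)^2 + 7 * (of_nat n + 1) + 3) * D (Suc n)
        + 9 * (of_nat n + 1)^3 * D n = 0"
      unfolding D_def tL_def by (rule quartic_recurrence_left)
    show "9 * (of_nat n + 2)^3 * E (Suc (Suc n))
        + (2 * of_nat n + 3) * (7 * (of_nat n + 1)^2 + 7 * (of_nat n + 1) + 3) * E (Suc n)
        + 9 * (of_nat n + 1)^3 * E n = 0"
      unfolding E_def tR_def by (rule quartic_recurrence_right)
    have "of_nat (Suc (Suc n)) \<noteq> (0 :: complex)"
      by (simp only: of_nat_eq_0_iff)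
    then show "9 * (of_nat n + 2 :: complex)^3 \<noteq> 0"
      by (simp add: add.commute)
  next
    show "D 0 = E 0"
      by (simp add: D_def E_def tL_def tR_def binom_square_sum_def)
    have "rGamma 2 = (1::complex)"
      using rGamma_of_nat_diff[of 0 1] by simp
    then show "D 1 = E 1"
      by (simp add: D_def E_def tL_def tR_def binom_square_sum_def eval_nat_numeral)
  qed
  moreover have "(\<Sum>m | 1 * m
      \<le> n. (of_nat ((2*m) choose m) * of_nat (binom_square_sum m) / 9^m) *
      of_nat ((n - 1 * m + 2 * m) choose (2 * m)) * (-1 :: complex)^(n - 1 * m)) = D n"
    unfolding D_def
  proof (intro sum.cong)
    fix m assume "m \<in> {..n}"
    then have m: "m \<le> n" by simp
    have "(-1::complex)^n * (-1/9)^m = (-1)^(n - m) / 9^m"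
    proof -
      have "(-1::complex)^n = (-1)^(n - m) * (-1)^m"
        using m by (simp flip: power_add)
      moreover have "(-1::complex)^m * (-1/9)^m = (1/9)^m"
        by (simp flip: power_mult_distrib)
      ultimately show ?thesis by (simp add: power_divide mult.assoc)
    qed
    moreover have "n - 1 * m + 2 * m - 2 * m = n - m" "n - 1 * m + 2 * m = n + m"
      using m by simp_all
    then have "of_nat ((n - 1 * m + 2 * m) choose (2 * m))
        = (fact (n + m) / (fact (2 * m) * fact (n - m)) :: complex)"
      using binomial_fact[of "2 * m" "n - 1 * m + 2 * m", where 'a = complex]
        by (simp add: add.commute)
    ultimately show "(of_nat ((2*m) choose m) * of_nat (binom_square_sum m) / 9^m) *
      of_nat ((n - 1 * m + 2 * m) choose (2 * m)) * (-1 :: complex)^(n - 1 * m) = tL n m"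
      unfolding tL_def central_binomial_fact rGamma_of_nat_diff[OF m]
      by (simp add: field_simps)
  qed auto
  moreover have "(\<Sum>m | 1 * m \<le> n. (fact (4*m) / (fact m^4 * 9^m)) *
      of_nat ((n - 1 * m + 4 * m) choose (4 * m)) * (-3 :: complex)^(n - 1 * m)) = E n"
    unfolding E_def
  proof (intro sum.cong)
    fix m assume "m \<in> {..n}"
    then have m: "m \<le> n" by simp
    have 1: "(-3::complex)^n * (-1/27)^m = (-3)^(n - m) / 9^m"
    proof -
      have "(-3::complex)^n = (-3)^(n - m) * (-3)^m"
        using m by (simp flip: power_add)
      moreover have "(-3::complex)^m * (-1/27)^m = (1/9)^m"
        by (simp flip: power_mult_distrib)
      ultimately show ?thesis by (simp add: power_divide mult.assoc)
    qed
    have "n - 1 * m + 4 * m - 4 * m = n - m" "n - 1 * m + 4 * m = n + 3 * m"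
      using m by simp_all
    then have 2: "of_nat ((n - 1 * m + 4 * m) choose (4 * m))
        = (fact (n + 3 * m) / (fact (4 * m) * fact (n - m)) :: complex)"
      using binomial_fact[of "4 * m" "n - 1 * m + 4 * m", where 'a = complex]
        by (simp add: add.commute)
    show "(fact (4*m) / (fact m^4 * 9^m)) *
      of_nat ((n - 1 * m + 4 * m) choose (4 * m)) * (-3 :: complex)^(n - 1 * m) = tR n m"
      unfolding tR_def rGamma_of_nat_diff[OF m] 1 2 by (simp add: field_simps)
  qed auto
  ultimately show ?thesis by simp
qed

section \<open>Hypergeometric coefficients as factorial quotients\<close>

text \<open>Here 108 = 4 * 27: (1/2)_n * n! * 4^n = (2n)! and (1/3)_n * (2/3)_n * n! * 27^n = (3n)!.
  The two parameters 1 and the series itself contribute n!^3 to the denominator.\<close>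

lemma hyp3F2_term_cubic:
  "hyp3F2_term (1/3) (1/2) (2/3) 1 1 (108 * x) n =
    of_nat (((2*n) choose n)^2 * ((3*n) choose n)) * x^n"
proof -
  have poch: "pochhammer (1/3) n * pochhammer (1/2) n * pochhammer (2/3) n * 108^n * fact n^2
      = (fact (2 * n) * fact (3 * n) :: complex)"
  proof (induction n)
    case (Suc n)
    have "fact (3 * Suc n)
        = (3 * of_nat n + 3) * (3 * of_nat n + 2) * (3 * of_nat n + 1) * (fact (3 * n) :: complex)"
      by (simp add: eval_nat_numeral algebra_simps)
    then have "fact (2 * Suc n) * fact (3 * Suc n) = 2 * (of_nat n + 1) * (2 * of_nat n + 1) *
       ((3 * of_nat n + 3) * (3 * of_nat n + 2) * (3 * of_nat n + 1)) * (fact (2 * n) * fact (3 * n) :: complex)"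
      unfolding fact_double_Suc by simp
    moreover have "fact (Suc n) = (of_nat n + 1) * (fact n :: complex)" by (simp add: add.commute)
    ultimately show ?case
      unfolding Suc.IH[symmetric] pochhammer_Suc power_Suc
        by (simp add: field_simps power2_eq_square)
  qed simp
  have "of_nat (((2*n) choose n)^2 * ((3*n) choose n))
      = (fact (2 * n) * fact (3 * n) / fact n^5 :: complex)"
  proof -
    have "of_nat ((3*n) choose n) = (fact (3 * n) / (fact n * fact (2 * n)) :: complex)"
      using binomial_fact[of n "3 * n", where 'a = complex] by simp
    then show ?thesis
      unfolding of_nat_mult of_nat_power central_binomial_fact
      by (simp add: field_simps eval_nat_numeral del: fact_Suc)
  qed
  then show ?thesis
    unfolding poch[symmetric]
      by (simp add: hyp3F2_term_def pochhammer_fact[symmetric] power_mult_distrib field_simps eval_nat_numeral)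
qed

text \<open>Here 256 = 4^4, from splitting (4n)! according to residues modulo 4.\<close>

lemma hyp3F2_term_quartic:
  "hyp3F2_term (1/4) (1/2) (3/4) 1 1 (256 * x) n = fact (4 * n) / fact n^4 * x^n"
proof -
  have poch: "pochhammer (1/4) n * pochhammer (1/2) n * pochhammer (3/4) n * 256^n * fact n
      = (fact (4 * n) :: complex)"
  proof (induction n)
    case (Suc n)
    have "fact (4 * Suc n)
        = (4 * of_nat n + 4) * (4 * of_nat n + 3) * (4 * of_nat n + 2) * (4 * of_nat n + 1) * (fact (4 * n) :: complex)"
      by (simp add: eval_nat_numeral algebra_simps)
    moreover have "fact (Suc n) = (of_nat n + 1) * (fact n :: complex)" by (simp add: add.commute)
    ultimately show ?case
      unfolding Suc.IH[symmetric] pochhammer_Suc power_Suc by (simp add: field_simps)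
  qed simp
  then show ?thesis
    unfolding poch[symmetric]
      by (simp add: hyp3F2_term_def pochhammer_fact[symmetric] power_mult_distrib field_simps eval_nat_numeral)
qed

section \<open>Geometric growth bounds\<close>

text \<open>Any geometric bound serves for convergence near 0. Here 16 = 4 * 2 * 2: the central
  binomial, one binomial bounded by 2^n, and the row sum of the other.\<close>

lemma binom_square_sum_le: "binom_square_sum n \<le> 16^n"
proof -
  have "binom_square_sum n \<le> (\<Sum>k\<le>n. (n choose k) * 8^n)"
    unfolding binom_square_sum_def
  proof (rule sum_mono)
    fix k assume "k \<in> {..n}"
    then have "(2*k choose k) \<le> 2^(2*n)"
      using binomial_le_pow2[of "2*k" k] power_increasing[of "2*k" "2*n" "2::nat"]
        by (simp add: order_trans)
    then have "(2*k choose k) * (n choose k) \<le> 2^(2*n) * 2^n"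
      using binomial_le_pow2[of n k] by (intro mult_mono) auto
    also have "\<dots> = (8::nat)^n"
      by (simp add: power_mult flip: power_mult_distrib)
    finally show "(2*k choose k) * (n choose k)^2 \<le> (n choose k) * 8^n"
      by (simp add: power2_eq_square)
  qed
  also have "\<dots> = 2^n * 8^n"
    by (simp only: choose_row_sum flip: sum_distrib_right)
  finally show ?thesis by (simp flip: power_mult_distrib)
qed

lemma central_binomial_le: "((2*n) choose n) \<le> 4^n"
  using binomial_le_pow2[of "2*n" n] by (simp add: power_mult)

theorem theorem4:
  shows
    "(\<exists>r>0. \<forall>u::complex. norm u < r \<longrightarrow>
        summable (hyp3F2_term (1/3) (1/2) (2/3) 1 1 (108 * u^2 / (1 - 4*u)^3)) \<and>
        summable (\<lambda>n. u^n * of_nat (\<Sum>k=0..n.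
          ((2*n - 2*k) choose (n - k)) * ((2*k) choose k) * (n choose k)^2)) \<and>
        hyp3F2 (1/3) (1/2) (2/3) 1 1 (108 * u^2 / (1 - 4*u)^3) =
          (1 - 4*u) * (\<Sum>n. u^n * of_nat (\<Sum>k=0..n.
            ((2*n - 2*k) choose (n - k)) * ((2*k) choose k) * (n choose k)^2)))
     \<and>
     (\<exists>r>0. \<forall>u::complex. norm u < r \<longrightarrow>
        summable (hyp3F2_term (1/4) (1/2) (3/4) 1 1 (256 * u / (9 * (1 + 3*u)^4))) \<and>
        summable (\<lambda>n. (u / (9 * (1 + u)^2))^n * of_nat ((2*n) choose n) *
          of_nat (\<Sum>k=0..n. ((2*k) choose k) * (n choose k)^2)) \<and>
        hyp3F2 (1/4) (1/2) (3/4) 1 1 (256 * u / (9 * (1 + 3*u)^4)) =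
          (1 + 3*u) / (1 + u) *
            (\<Sum>n. (u / (9 * (1 + u)^2))^n * of_nat ((2*n) choose n) *
              of_nat (\<Sum>k=0..n. ((2*k) choose k) * (n choose k)^2)))"
proof (intro conjI)
  show "\<exists>r>0. \<forall>u::complex. norm u < r \<longrightarrow>
        summable (hyp3F2_term (1/3) (1/2) (2/3) 1 1 (108 * u^2 / (1 - 4*u)^3)) \<and>
        summable (\<lambda>n. u^n * of_nat (\<Sum>k=0..n.
          ((2*n - 2*k) choose (n - k)) * ((2*k) choose k) * (n choose k)^2)) \<and>
        hyp3F2 (1/3) (1/2) (2/3) 1 1 (108 * u^2 / (1 - 4*u)^3) =
          (1 - 4*u) * (\<Sum>n. u^n * of_nat (\<Sum>k=0..n.
            ((2*n - 2*k) choose (n - k)) * ((2*k) choose k) * (n choose k)^2))"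
  proof -
    have bound: "norm (of_nat (((2*m) choose m)^2 * ((3*m) choose m)) :: complex) \<le> 128^m" for m
    proof -
      have "((2*m) choose m)^2 * ((3*m) choose m) \<le> (4^m)^2 * 2^(3*m)"
        by (intro mult_mono power_mono central_binomial_le binomial_le_pow2) auto
      also have "\<dots> = 128^m"
        by (simp add: power_mult power2_eq_square flip: power_mult_distrib)
      finally show ?thesis
        unfolding norm_of_nat by (metis of_nat_le_iff of_nat_power of_nat_numeral)
    qed
    obtain r where "r > 0" and r: "\<And>u :: complex. norm u < r \<Longrightarrow> 4 * u \<noteq> 1 \<and>
        summable (\<lambda>m. of_nat (((2*m) choose m)^2 * ((3*m) choose m)) * (u^2 / (1 - 4 * u)^3)^m) \<and>
        (\<lambda>n. u^n * of_nat (\<Sum>k=0..n. ((2*n - 2*k) choose (n - k)) * ((2*k) choose k) * (n choose k)^2))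
          sums ((\<Sum>m. of_nat (((2*m) choose m)^2 * ((3*m) choose m)) * (u^2 / (1 - 4 * u)^3)^m) / (1 - 4 * u))"
      using rational_substitution_sums[OF bound, of 2 4 3] unfolding Domb_number_identity[symmetric]
        by auto
    have *: "hyp3F2_term (1/3) (1/2) (2/3) 1 1 (108 * u^2 / (1 - 4*u)^3) =
        (\<lambda>m. of_nat (((2*m) choose m)^2 * ((3*m) choose m)) * (u^2 / (1 - 4 * u)^3)^m)" for u
      using hyp3F2_term_cubic[of "u^2 / (1 - 4*u)^3"] by (intro ext) simp
    show ?thesis
      unfolding hyp3F2_def *
    proof (intro exI[of _ r] conjI allI impI \<open>r > 0\<close>)
      fix u :: complex assume "norm u < r"
      note r = r[OF this]
      show "summable (\<lambda>m. of_nat (((2*m) choose m)^2 * ((3*m) choose m)) * (u^2 / (1 - 4 * u)^3)^m)"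
        and "summable (\<lambda>n. u^n * of_nat (\<Sum>k=0..n. ((2*n - 2*k) choose (n - k)) * ((2*k) choose k) * (n choose k)^2))"
        using r by (auto dest: sums_summable)
      show "(\<Sum>m. of_nat (((2*m) choose m)^2 * ((3*m) choose m)) * (u^2 / (1 - 4 * u)^3)^m) =
          (1 - 4*u) * (\<Sum>n. u^n * of_nat (\<Sum>k=0..n.
            ((2*n - 2*k) choose (n - k)) * ((2*k) choose k) * (n choose k)^2))"
        using r by (auto dest!: sums_unique[symmetric])
    qed
  qed
next
  show "\<exists>r>0. \<forall>u::complex. norm u < r \<longrightarrow>
        summable (hyp3F2_term (1/4) (1/2) (3/4) 1 1 (256 * u / (9 * (1 + 3*u)^4))) \<and>
        summable (\<lambda>n. (u / (9 * (1 + u)^2))^n * of_nat ((2*n) choose n) *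
          of_nat (\<Sum>k=0..n. ((2*k) choose k) * (n choose k)^2)) \<and>
        hyp3F2 (1/4) (1/2) (3/4) 1 1 (256 * u / (9 * (1 + 3*u)^4)) =
          (1 + 3*u) / (1 + u) *
            (\<Sum>n. (u / (9 * (1 + u)^2))^n * of_nat ((2*n) choose n) *
              of_nat (\<Sum>k=0..n. ((2*k) choose k) * (n choose k)^2))"
  proof -
    define cL cR :: "nat \<Rightarrow> complex"
      where "cL m = of_nat ((2*m) choose m) * of_nat (binom_square_sum m) / 9^m"
        and "cR m = fact (4*m) / (fact m^4 * 9^m)" for m
    have norm_le: "norm (x / 9^m) \<le> norm x" for x :: complex and m :: nat
      by (simp add: norm_divide norm_power divide_le_eq mult_le_cancel_left1)
    have boundL: "norm (cL m) \<le> 64^m" for m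
    proof -
      have "((2*m) choose m) * binom_square_sum m \<le> 4^m * 16^m"
        by (intro mult_mono central_binomial_le binom_square_sum_le) auto
      also have "\<dots> = 64^m"
        by (simp flip: power_mult_distrib)
      finally have "real (((2*m) choose m) * binom_square_sum m) \<le> 64^m"
        by (metis of_nat_le_iff of_nat_power of_nat_numeral)
      moreover have "norm (cL m) \<le> real (((2*m) choose m) * binom_square_sum m)"
        using norm_le[of "of_nat (((2*m) choose m) * binom_square_sum m)" m] unfolding cL_def norm_of_nat
          by simp
      ultimately show ?thesis by linarith
    qed
    have boundR: "norm (cR m) \<le> 256^m" for m
    proof -
      have "((4*m) choose (2*m)) * ((2*m) choose m)^2 \<le> 2^(4*m) * (4^m)^2"
        by (intro mult_mono power_mono central_binomial_le binomial_le_pow2) auto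
      also have "\<dots> = 256^m"
        by (simp add: power_mult power2_eq_square flip: power_mult_distrib)
      finally have "real (((4*m) choose (2*m)) * ((2*m) choose m)^2) \<le> 256^m"
        by (metis of_nat_le_iff of_nat_power of_nat_numeral)
      \<comment> \<open>Writing (4m)!/m!^4 as a product of central binomials yields the bound 16^m *
        16^m.\<close>
      moreover have "cR m = of_nat (((4*m) choose (2*m)) * ((2*m) choose m)^2) / 9^m"
      proof -
        have "of_nat ((4*m) choose (2*m))
            = (fact (4 * m) / (fact (2 * m) * fact (2 * m)) :: complex)"
          using binomial_fact[of "2*m" "4*m", where 'a = complex] by simp
        then show ?thesis
          unfolding cR_def of_nat_mult of_nat_power central_binomial_fact
          by (simp add: field_simps eval_nat_numeral del: fact_Suc)
      qed
      then have "norm (cR m) \<le> real (((4*m) choose (2*m)) * ((2*m) choose m)^2)"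
        by (metis norm_le norm_of_nat)
      ultimately show ?thesis by linarith
    qed
    obtain rL where "rL > 0" and rL: "\<And>u :: complex. norm u < rL \<Longrightarrow> -1 * u \<noteq> 1 \<and>
        summable (\<lambda>m. cL m * (u^1 / (1 - (-1) * u)^2)^m) \<and>
        (\<lambda>n. u^n * (\<Sum>m | 1 * m \<le> n. cL m * of_nat ((n - 1 * m + 2 * m) choose (2 * m)) * (-1)^(n - 1 * m)))
          sums ((\<Sum>m. cL m * (u^1 / (1 - (-1) * u)^2)^m) / (1 - (-1) * u))"
      using rational_substitution_sums[OF boundL, of 1 "-1" 2] by auto
    obtain rR where "rR > 0" and rR: "\<And>u :: complex. norm u < rR \<Longrightarrow> -3 * u \<noteq> 1 \<and>
        summable (\<lambda>m. cR m * (u^1 / (1 - (-3) * u)^4)^m) \<and>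
        (\<lambda>n. u^n * (\<Sum>m | 1 * m \<le> n. cR m * of_nat ((n - 1 * m + 4 * m) choose (4 * m)) * (-3)^(n - 1 * m)))
          sums ((\<Sum>m. cR m * (u^1 / (1 - (-3) * u)^4)^m) / (1 - (-3) * u))"
      using rational_substitution_sums[OF boundR, of 1 "-3" 4] by auto
    have R: "hyp3F2_term (1/4) (1/2) (3/4) 1 1 (256 * u / (9 * (1 + 3*u)^4)) =
        (\<lambda>m. cR m * (u^1 / (1 - (-3) * u)^4)^m)" for u
      using hyp3F2_term_quartic[of "u / (9 * (1 + 3*u)^4)"]
      by (intro ext) (simp add: cR_def power_mult_distrib power_divide)
    have L: "(\<lambda>n. (u / (9 * (1 + u)^2))^n * of_nat ((2*n) choose n) *
          of_nat (\<Sum>k=0..n. ((2*k) choose k) * (n choose k)^2)) =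
        (\<lambda>m. cL m * (u^1 / (1 - (-1) * u)^2)^m)" for u
      by (intro ext)
        (simp add: cL_def binom_square_sum_def atLeast0AtMost power_mult_distrib power_divide del: of_nat_sum)
    show ?thesis
      unfolding hyp3F2_def R L
    proof (intro exI[of _ "min rL rR"] conjI allI impI)
      show "min rL rR > 0" using \<open>rL > 0\<close> \<open>rR > 0\<close> by simp
      fix u :: complex assume "norm u < min rL rR"
      then have u: "norm u < rL" "norm u < rR" by simp_all
      note rL = rL[OF u(1)] and rR = rR[OF u(2)]
      show "summable (\<lambda>m. cR m * (u^1 / (1 - (-3) * u)^4)^m)"
        and "summable (\<lambda>m. cL m * (u^1 / (1 - (-1) * u)^2)^m)"
        using rL rR by blast+
      \<comment> \<open>By \<open>quartic_identity\<close> both quotients are sums of the same power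
        series in u.\<close>
      have "(\<Sum>m. cL m * (u^1 / (1 - (-1) * u)^2)^m) / (1 - (-1) * u) =
          (\<Sum>m. cR m * (u^1 / (1 - (-3) * u)^4)^m) / (1 - (-3) * u)"
        using rL rR unfolding cL_def cR_def quartic_identity by (meson sums_unique2)
      moreover have "1 + u \<noteq> 0" "1 + 3 * u \<noteq> 0"
        using rL rR by (auto simp: add_eq_0_iff2)
      ultimately show "(\<Sum>m. cR m * (u^1 / (1 - (-3) * u)^4)^m) =
          (1 + 3*u) / (1 + u) * (\<Sum>m. cL m * (u^1 / (1 - (-1) * u)^2)^m)"
        by (simp add: field_simps)
    qed
  qed
qed

end
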